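(* Let $G$ be a finite simple $d$-regular graph with at least two vertices and with independence number $i(G)$, and let $p$ be a real number with $0\le p\le 1$. Then $$t_e(G,p)\leq (1-p^d)^{i(G)}.$$
   Context: Graphs are finite, simple and undirected. A graph is $d$-regular if every vertex has exactly $d$ adjacent vertices. The independence number $i(G)$ is the maximum number of pairwise non-adjacent vertices in $G$. For a graph $G$ and a real number $p$ with $0\le p\le 1$, the edge-fault (EF) tolerance $t_e(G,p)$ is the probability that $G$ is connected when all vertices are perfectly reliable and each edge fails (is deleted) independently with probability $p$; that is, the probability that the random spanning subgraph of $G$ (on the full vertex set) formed by the non-failed edges is connected. The convention $p^0=1$ is used. *)

theory Defs
  imports
    "HOL-Probability.Product_PMF"
    "Graph_Theory.Pair_Digraph"
    "Graph_Theory.Digraph_Component"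
begin

text \<open>
  A finite simple undirected graph is a \<^locale>\<open>pair_graph\<close>: a finite, loop-free, symmetric
  relation on a finite vertex set. An undirected edge is represented there by the two arcs
  \<open>(u, v)\<close> and \<open>(v, u)\<close>. Since an edge fails as a whole, faults are indexed by the
  two-element sets \<open>{u, v}\<close> and not by arcs.
\<close>

definition edges :: "'a pair_pre_digraph \<Rightarrow> 'a set set" where
  "edges G = {{u, v} | u v. (u, v) \<in> parcs G}"

definition regular :: "'a pair_pre_digraph \<Rightarrow> nat \<Rightarrow> bool" where
  "regular G d \<longleftrightarrow> (\<forall>v \<in> pverts G. card {w \<in> pverts G. (v, w) \<in> parcs G} = d)"

definition independent_set :: "'a pair_pre_digraph \<Rightarrow> 'a set \<Rightarrow> bool" where
  "independent_set G S \<longleftrightarrow> S \<subseteq> pverts G \<and> pairwise (\<lambda>u v. (u, v) \<notin> parcs G) S"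

definition independence_number :: "'a pair_pre_digraph \<Rightarrow> nat" where
  "independence_number G = Max (card ` {S. independent_set G S})"

definition delete_edges :: "'a pair_pre_digraph \<Rightarrow> 'a set set \<Rightarrow> 'a pair_pre_digraph" where
  "delete_edges G F = \<lparr> pverts = pverts G, parcs = {(u, v) \<in> parcs G. {u, v} \<notin> F} \<rparr>"

text \<open>
  A fault configuration \<open>x\<close> has independent components, one for each edge, and \<open>x e\<close> is true,
  with probability \<open>p\<close>, iff \<open>e\<close> fails. The constant \<open>connected\<close> is qualified because
  the topological one has the same name.
\<close>

definition ef_tolerance :: "'a pair_pre_digraph \<Rightarrow> real \<Rightarrow> real" where
  "ef_tolerance G p =
     measure_pmf.prob (Pi_pmf (edges G) False (\<lambda>_. bernoulli_pmf p))
       {x. Digraph_Component.connected (with_proj (delete_edges G {e. x e}))}"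

end

theory Submission
  imports Defs
begin

text \<open>
  A connected graph on at least two vertices has no isolated vertex. Hence, if the surviving edges
  connect \<open>G\<close>, then around every vertex some incident edge survives. At a single vertex of degree
  \<open>d\<close> this has probability \<open>1 - p ^ d\<close>. For the vertices of an independent set \<open>S\<close> these events
  are independent of each other, because an edge meets \<open>S\<close> in at most one vertex and so the sets of
  edges around distinct members of \<open>S\<close> are disjoint. The probability that no vertex of \<open>S\<close> is
  isolated is therefore exactly \<open>(1 - p ^ d) ^ card S\<close>; an independent set of maximum size gives
  the bound. The probabilistic half is \<open>prob_some_survivor_in_blocks\<close>, the graph-theoretic half is
  \<open>connected_imp_surviving_edge\<close> together with \<open>disjoint_incident_edges\<close>.

  The case \<open>d = 0\<close> needs no separate treatment: then the bound is \<open>0\<close>, and an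
  empty set of incident edges has no survivor.
\<close>

section \<open>Survivors in disjoint blocks of independent components\<close>

text \<open>
  Independence of the components passes to tuples over disjoint index blocks, and from there to
  events that are determined by one block each.
\<close>

lemma prob_some_survivor_in_blocks:
  fixes q :: "'i \<Rightarrow> bool pmf" and B :: "'j \<Rightarrow> 'i set"
  assumes A: "finite A" and S: "finite S"
    and sub: "\<And>j. j \<in> S \<Longrightarrow> B j \<subseteq> A"
    and disj: "disjoint_family_on B S"
  shows "measure_pmf.prob (Pi_pmf A dflt q) {x. \<forall>j\<in>S. \<exists>i\<in>B j. \<not> x i} =
           (\<Prod>j\<in>S. 1 - (\<Prod>i\<in>B j. pmf (q i) True))"
proof (cases "S = {}")
  case True
  then show ?thesis by simp
next
  case False
  define P where "P = Pi_pmf A dflt q"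
  have P: "prob_space P"
    by (rule measure_pmf.prob_space_axioms)
  define survivor where "survivor = (\<lambda>j x. \<exists>i\<in>B j. \<not> x i)"
  have finB: "finite (B j)" if "j \<in> S" for j
    using sub[OF that] A by (rule finite_subset)
  have "prob_space.indep_vars P (\<lambda>_. count_space UNIV) (\<lambda>i x. x i) A"
    unfolding P_def by (rule indep_vars_Pi_pmf[OF A])
  then have "prob_space.indep_vars P (\<lambda>j. PiM (B j) (\<lambda>_. count_space UNIV))
               (\<lambda>j x. restrict (\<lambda>i. x i) (B j)) S"
    by (rule prob_space.indep_vars_restrict[OF P _ sub disj])
  then have "prob_space.indep_vars P (\<lambda>_. count_space UNIV)
               (\<lambda>j x. survivor j (restrict (\<lambda>i. x i) (B j))) S"
  proof (rule prob_space.indep_vars_compose2[OF P])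
    fix j assume "j \<in> S"
    then have [measurable]: "countable (B j)"
      using finB countable_finite by blast
    show "survivor j \<in> measurable (PiM (B j) (\<lambda>_. count_space UNIV)) (count_space UNIV)"
      unfolding survivor_def using \<open>j \<in> S\<close> finB by measurable
  qed
  from prob_space.indep_varsD_finite[OF P this False S, where A = "\<lambda>_. {True}"]
  have "measure_pmf.prob P (\<Inter>j\<in>S. {x. survivor j x}) =
          (\<Prod>j\<in>S. measure_pmf.prob P {x. survivor j x})"
    by (simp add: survivor_def vimage_def)
  also have "(\<Inter>j\<in>S. {x. survivor j x}) = {x. \<forall>j\<in>S. \<exists>i\<in>B j. \<not> x i}"
    by (auto simp: survivor_def)
  also have "(\<Prod>j\<in>S. measure_pmf.prob P {x. survivor j x}) =
               (\<Prod>j\<in>S. 1 - (\<Prod>i\<in>B j. pmf (q i) True))"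
  proof (rule prod.cong[OF refl])
    fix j assume j: "j \<in> S"
    have "{x. survivor j x} = UNIV - (Pi A (\<lambda>i. if i \<in> B j then {True} else UNIV))"
      using sub[OF j] by (auto simp: survivor_def Pi_def split: if_splits)
    then have "measure_pmf.prob P {x. survivor j x} =
                 1 - measure_pmf.prob P (Pi A (\<lambda>i. if i \<in> B j then {True} else UNIV))"
      using measure_pmf.prob_compl[of "Pi A (\<lambda>i. if i \<in> B j then {True} else UNIV)" P] by simp
    also have "measure_pmf.prob P (Pi A (\<lambda>i. if i \<in> B j then {True} else UNIV)) =
                 (\<Prod>i\<in>A. if i \<in> B j then pmf (q i) True else 1)"
      unfolding P_def using A
      by (auto simp: measure_Pi_pmf_Pi measure_pmf_single intro!: prod.cong)
    also have "\<dots> = (\<Prod>i\<in>B j. pmf (q i) True)"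
      using sub[OF j] A by (simp add: prod.If_cases Int_absorb1)
    finally show "measure_pmf.prob P {x. survivor j x} = 1 - (\<Prod>i\<in>B j. pmf (q i) True)" .
  qed
  finally show ?thesis by (simp add: P_def)
qed

section \<open>Edges around a vertex\<close>

definition incident_edges :: "'a pair_pre_digraph \<Rightarrow> 'a \<Rightarrow> 'a set set" where
  "incident_edges G v = {e \<in> edges G. v \<in> e}"

lemma incident_edges_subset: "incident_edges G v \<subseteq> edges G"
  by (auto simp: incident_edges_def)

lemma incident_edges_eq:
  assumes "pair_graph G"
  shows "incident_edges G v = (\<lambda>w. {v, w}) ` {w \<in> pverts G. (v, w) \<in> parcs G}"
proof -
  interpret pair_graph G by fact
  have "sym (parcs G)"
    using pair_sym_arcs by (simp add: symmetric_def)
  then show ?thesis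
    by (auto simp: incident_edges_def edges_def insert_commute dest: in_arcsD2 symD)
qed

text \<open>Without loops and parallel edges, an edge at \<open>v\<close> is determined by its other endpoint.\<close>

lemma card_incident_edges:
  assumes "pair_graph G" "regular G d" "v \<in> pverts G"
  shows "card (incident_edges G v) = d"
proof -
  have "inj_on (\<lambda>w. {v, w}) {w \<in> pverts G. (v, w) \<in> parcs G}"
    by (auto simp: inj_on_def doubleton_eq_iff)
  then show ?thesis
    using assms by (simp add: incident_edges_eq card_image regular_def)
qed

lemma finite_edges:
  assumes "pair_graph G"
  shows "finite (edges G)"
proof -
  interpret pair_graph G by fact
  have "edges G = (\<lambda>(u, v). {u, v}) ` parcs G"
    by (auto simp: edges_def)
  then show ?thesis
    using pair_finite_arcs by simp
qed

text \<open>A common edge of two distinct vertices would join them.\<close>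

lemma disjoint_incident_edges:
  assumes "pair_graph G" "independent_set G S"
  shows "disjoint_family_on (incident_edges G) S"
  using assms(2)
  by (auto simp: disjoint_family_on_def incident_edges_eq[OF assms(1)] independent_set_def
      pairwise_def doubleton_eq_iff)

text \<open>The first step of a walk from \<open>v\<close> to any other vertex uses a surviving edge at \<open>v\<close>.\<close>

lemma connected_imp_surviving_edge:
  assumes "card (pverts G) \<ge> 2" "v \<in> pverts G"
    and conn: "Digraph_Component.connected (with_proj (delete_edges G F))"
  shows "\<exists>e \<in> incident_edges G v. e \<notin> F"
proof -
  let ?H = "with_proj (mk_symmetric (with_proj (delete_edges G F)))"
  obtain u where u: "u \<in> pverts G" "u \<noteq> v"
    using assms(1) by (metis card_2_iff' ex_card subset_iff)
  have "v \<rightarrow>\<^sup>*\<^bsub>?H\<^esub> u"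
    using conn u assms(2)
    by (auto simp: connected_def strongly_connected_def delete_edges_def)
  then obtain w where "(v, w) \<in> parcs (mk_symmetric (with_proj (delete_edges G F)))"
    using u(2) by (auto elim: pre_digraph.converse_reachable_cases)
  then have "(v, w) \<in> parcs (delete_edges G F) \<or> (w, v) \<in> parcs (delete_edges G F)"
    by (auto simp: parcs_mk_symmetric)
  then have "{v, w} \<in> incident_edges G v \<and> {v, w} \<notin> F"
    by (auto simp: delete_edges_def incident_edges_def edges_def insert_commute)
  then show ?thesis by blast
qed

lemma maximum_independent_set_exists:
  assumes "finite (pverts G)"
  obtains S where "independent_set G S" "card S = independence_number G"
proof -
  have "{S. independent_set G S} \<subseteq> Pow (pverts G)"
    by (auto simp: independent_set_def)
  then have "finite {S. independent_set G S}"
    using assms by (meson finite_Pow_iff finite_subset)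
  moreover have "independent_set G {}"
    by (simp add: independent_set_def)
  ultimately have "independence_number G \<in> card ` {S. independent_set G S}"
    unfolding independence_number_def by (intro Max_in) auto
  then show ?thesis
    using that by auto
qed

section \<open>The bound on the edge-fault tolerance\<close>

theorem mainTheorem1:
  fixes G :: "'a pair_pre_digraph" and d :: nat and p :: real
  assumes "pair_graph G"
    and "card (pverts G) \<ge> 2"
    and "regular G d"
    and "0 \<le> p" and "p \<le> 1"
  shows "ef_tolerance G p \<le> (1 - p ^ d) ^ independence_number G"
proof -
  interpret pair_graph G by fact
  obtain S where S: "independent_set G S" "card S = independence_number G"
    using maximum_independent_set_exists[OF pair_finite_verts] .
  then have sub: "S \<subseteq> pverts G"
    by (simp add: independent_set_def)
  then have finS: "finite S"
    using pair_finite_verts finite_subset by blast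
  let ?P = "Pi_pmf (edges G) False (\<lambda>_. bernoulli_pmf p)"
  have "ef_tolerance G p \<le> measure_pmf.prob ?P {x. \<forall>v\<in>S. \<exists>e\<in>incident_edges G v. \<not> x e}"
    unfolding ef_tolerance_def
    using connected_imp_surviving_edge[OF assms(2)] sub
    by (intro measure_pmf.finite_measure_mono) fastforce+
  also have "\<dots> = (\<Prod>v\<in>S. 1 - (\<Prod>e\<in>incident_edges G v. pmf (bernoulli_pmf p) True))"
    using finite_edges[OF assms(1)] finS disjoint_incident_edges[OF assms(1) S(1)]
    by (intro prob_some_survivor_in_blocks) (blast dest: subsetD[OF incident_edges_subset])+
  also have "\<dots> = (\<Prod>v\<in>S. 1 - p ^ d)"
    using sub assms card_incident_edges[OF assms(1,3)] by (intro prod.cong) auto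
  also have "\<dots> = (1 - p ^ d) ^ independence_number G"
    using S(2) by simp
  finally show ?thesis .
qed

end
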